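(* Let $d \geq 2$ be an integer, let $\mathbb{F}$ be a field, and let $V$ be a vector space over $\mathbb{F}$ of dimension $d+1$. Then the family of Quasi-Circular Hessenberg systems on $V$ is the disjoint union of the family of Circular Hessenberg systems on $V$ and the family of Tridiagonal Hessenberg systems on $V$. That is, a Hessenberg system on $V$ is QCHS if and only if it is CHS or THS, and no Hessenberg system on $V$ is both CHS and THS.
   Context: $\mathrm{End}(V)$ is the algebra of $\mathbb{F}$-linear maps $V\to V$. An element of $\mathrm{End}(V)$ is multiplicity-free if it is diagonalizable and every eigenspace has dimension one. For multiplicity-free $A$ with eigenspaces ordered $V_0,\dots,V_d$, the corresponding primitive idempotents are $E_0,\dots,E_d \in \mathrm{End}(V)$, where $E_i$ acts as the identity on $V_i$ and as $0$ on $V_j$ for $j\neq i$. The superscript $*$ in $A^*$, $E_i^*$ is just notation (not an adjoint). A Hessenberg system on $V$ is a sequence $\Phi=(A; \{E_i\}_{i=0}^d; A^*; \{E^*_i\}_{i=0}^d)$ of elements of $\mathrm{End}(V)$ such that: (i) $A$ and $A^*$ are multiplicity-free; (ii) $\{E_i\}_{i=0}^d$ is an ordering of the primitive idempotents of $A$; (iii) $\{E^*_i\}_{i=0}^d$ is an ordering of the primitive idempotents of $A^*$; (iv) for $0\le i,j\le d$, $E_iA^*E_j=0$ if $i-j>1$ and $E_iA^*E_j\neq 0$ if $i-j=1$; (v) for $0\le i,j\le d$, $E^*_iAE^*_j=0$ if $i-j>1$ and $E^*_iAE^*_j\neq 0$ if $i-j=1$. A Hessenberg system $\Phi$ is: -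 a Quasi-Circular Hessenberg system (QCHS) if for all $0\le i,j\le d$ with $1<j-i<d$ we have $E_iA^*E_j=0$ and $E^*_iAE^*_j=0$; - a Circular Hessenberg system (CHS) if for all $0\le i,j\le d$ with $1<j-i<d$ we have $E_iA^*E_j=0$ and $E^*_iAE^*_j=0$, and moreover $E_0A^*E_d\neq 0$ and $E^*_0AE^*_d\neq 0$; - a Tridiagonal Hessenberg system (THS) if for all $0\le i,j\le d$ with $1<j-i$ we have $E_iA^*E_j=0$ and $E^*_iAE^*_j=0$. *)

theory Defs
  imports Complex_Main
begin

text \<open>
  The vector space V is the whole type \<open>'v\<close>, with scalar multiplication \<open>scale\<close> over the
  field \<open>'f\<close>; End(V) is the set of maps satisfying \<open>Vector_Spaces.linear scale scale\<close>.
\<close>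

definition eigenspace :: "('f::field \<Rightarrow> 'v::ab_group_add \<Rightarrow> 'v) \<Rightarrow> ('v \<Rightarrow> 'v) \<Rightarrow> 'f \<Rightarrow> 'v set" where
  "eigenspace scale A c = {v. A v = scale c v}"

definition eigenvalue :: "('f::field \<Rightarrow> 'v::ab_group_add \<Rightarrow> 'v) \<Rightarrow> ('v \<Rightarrow> 'v) \<Rightarrow> 'f \<Rightarrow> bool" where
  "eigenvalue scale A c \<longleftrightarrow> (\<exists>v. v \<noteq> 0 \<and> A v = scale c v)"

definition eigenspaces :: "('f::field \<Rightarrow> 'v::ab_group_add \<Rightarrow> 'v) \<Rightarrow> ('v \<Rightarrow> 'v) \<Rightarrow> 'v set set" where
  "eigenspaces scale A = {eigenspace scale A c |c. eigenvalue scale A c}"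

definition diagonalizable :: "('f::field \<Rightarrow> 'v::ab_group_add \<Rightarrow> 'v) \<Rightarrow> ('v \<Rightarrow> 'v) \<Rightarrow> bool" where
  "diagonalizable scale A \<longleftrightarrow>
     (\<exists>B. \<not> module.dependent scale B \<and> module.span scale B = UNIV \<and>
          (\<forall>b\<in>B. \<exists>c. A b = scale c b))"

definition multiplicity_free :: "('f::field \<Rightarrow> 'v::ab_group_add \<Rightarrow> 'v) \<Rightarrow> ('v \<Rightarrow> 'v) \<Rightarrow> bool" where
  "multiplicity_free scale A \<longleftrightarrow>
     Vector_Spaces.linear scale scale A \<and> diagonalizable scale A \<and>
     (\<forall>W \<in> eigenspaces scale A. vector_space.dim scale W = 1)"

text \<open>
  A family indexed by 0, ..., d is a function on \<open>nat\<close> of which only the values at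
  indices \<open>\<le> d\<close> are ever constrained or used.
\<close>

definition primitive_idempotents ::
    "('f::field \<Rightarrow> 'v::ab_group_add \<Rightarrow> 'v) \<Rightarrow> nat \<Rightarrow> ('v \<Rightarrow> 'v) \<Rightarrow> (nat \<Rightarrow> 'v \<Rightarrow> 'v) \<Rightarrow> bool" where
  "primitive_idempotents scale d A E \<longleftrightarrow>
     (\<exists>W. bij_betw W {0..d} (eigenspaces scale A) \<and>
          (\<forall>i\<le>d. Vector_Spaces.linear scale scale (E i) \<and>
                  (\<forall>v \<in> W i. E i v = v) \<and>
                  (\<forall>j\<le>d. j \<noteq> i \<longrightarrow> (\<forall>v \<in> W j. E i v = 0))))"

type_synonym 'v system = "('v \<Rightarrow> 'v) \<times> (nat \<Rightarrow> 'v \<Rightarrow> 'v) \<times> ('v \<Rightarrow> 'v) \<times> (nat \<Rightarrow> 'v \<Rightarrow> 'v)"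

text \<open>The conditions on index differences are written additively, since subtraction on
  \<open>nat\<close> truncates.\<close>

definition hessenberg_system ::
    "('f::field \<Rightarrow> 'v::ab_group_add \<Rightarrow> 'v) \<Rightarrow> nat \<Rightarrow> 'v system \<Rightarrow> bool" where
  "hessenberg_system scale d = (\<lambda>(A, E, A', E').
     multiplicity_free scale A \<and> multiplicity_free scale A' \<and>
     primitive_idempotents scale d A E \<and>
     primitive_idempotents scale d A' E' \<and>
     (\<forall>i\<le>d. \<forall>j\<le>d.
        (i > j + 1 \<longrightarrow> E i \<circ> A' \<circ> E j = (\<lambda>_. 0)) \<and>
        (i = j + 1 \<longrightarrow> E i \<circ> A' \<circ> E j \<noteq> (\<lambda>_. 0))) \<and>
     (\<forall>i\<le>d. \<forall>j\<le>d.
        (i > j + 1 \<longrightarrow> E' i \<circ> A \<circ> E' j = (\<lambda>_. 0)) \<and>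
        (i = j + 1 \<longrightarrow> E' i \<circ> A \<circ> E' j \<noteq> (\<lambda>_. 0))))"

definition QCHS ::
    "('f::field \<Rightarrow> 'v::ab_group_add \<Rightarrow> 'v) \<Rightarrow> nat \<Rightarrow> 'v system set" where
  "QCHS scale d = {(A, E, A', E'). hessenberg_system scale d (A, E, A', E') \<and>
     (\<forall>i\<le>d. \<forall>j\<le>d. i + 1 < j \<and> j < i + d \<longrightarrow>
        E i \<circ> A' \<circ> E j = (\<lambda>_. 0) \<and> E' i \<circ> A \<circ> E' j = (\<lambda>_. 0))}"

definition CHS ::
    "('f::field \<Rightarrow> 'v::ab_group_add \<Rightarrow> 'v) \<Rightarrow> nat \<Rightarrow> 'v system set" where
  "CHS scale d = {(A, E, A', E'). hessenberg_system scale d (A, E, A', E') \<and>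
     (\<forall>i\<le>d. \<forall>j\<le>d. i + 1 < j \<and> j < i + d \<longrightarrow>
        E i \<circ> A' \<circ> E j = (\<lambda>_. 0) \<and> E' i \<circ> A \<circ> E' j = (\<lambda>_. 0)) \<and>
     E 0 \<circ> A' \<circ> E d \<noteq> (\<lambda>_. 0) \<and> E' 0 \<circ> A \<circ> E' d \<noteq> (\<lambda>_. 0)}"

definition THS ::
    "('f::field \<Rightarrow> 'v::ab_group_add \<Rightarrow> 'v) \<Rightarrow> nat \<Rightarrow> 'v system set" where
  "THS scale d = {(A, E, A', E'). hessenberg_system scale d (A, E, A', E') \<and>
     (\<forall>i\<le>d. \<forall>j\<le>d. i + 1 < j \<longrightarrow>
        E i \<circ> A' \<circ> E j = (\<lambda>_. 0) \<and> E' i \<circ> A \<circ> E' j = (\<lambda>_. 0))}"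

end

theory Submission
  imports Defs
begin

text \<open>
  Only the equivalence of the two corner conditions needs an argument. Suppose that \<open>A*\<close> is
  tridiagonal in an eigenbasis of \<open>A\<close>. Since its subdiagonal entries are nonzero, there is a
  nonzero diagonal (possibly degenerate) symmetric bilinear form for which \<open>A\<close> and \<open>A*\<close> are both
  self-adjoint, so that eigenvectors \<open>w 0, \<dots>, w d\<close> of \<open>A*\<close> are mutually orthogonal. Now
  \<open>\<langle>w 0, A (w d)\<rangle> = \<langle>A (w 0), w d\<rangle> = 0\<close> because \<open>A (w 0)\<close> lies in the span of \<open>w 0\<close> and \<open>w 1\<close>.
  If the \<open>(0, d)\<close> entry of \<open>A\<close> were nonzero, then \<open>w 0\<close> would be isotropic, hence in the
  radical; but the radical is \<open>A\<close>-invariant and \<open>w 0\<close> generates \<open>V\<close> under \<open>A\<close>, so the form would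
  vanish.
\<close>

section \<open>Coordinates in an eigenbasis\<close>

text \<open>Here \<open>v\<close> is an eigenbasis of \<open>A\<close> and \<open>f\<close> its dual
  basis, so \<open>f i (T (v j))\<close> is the \<open>(i, j)\<close> matrix entry of a linear map
  \<open>T\<close>. The argument is carried out on such entries, free of idempotents.\<close>

locale eigen_coordinates = vector_space scale
  for scale :: "'f::field \<Rightarrow> 'v::ab_group_add \<Rightarrow> 'v" +
  fixes d :: nat and A :: "'v \<Rightarrow> 'v" and v :: "nat \<Rightarrow> 'v"
    and f :: "nat \<Rightarrow> 'v \<Rightarrow> 'f" and \<theta> :: "nat \<Rightarrow> 'f"
  assumes coord_add: "i \<le> d \<Longrightarrow> f i (x + y) = f i x + f i y"
    and coord_scale: "i \<le> d \<Longrightarrow> f i (scale c x) = c * f i x"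
    and coord_basis: "i \<le> d \<Longrightarrow> j \<le> d \<Longrightarrow> f i (v j) = (if i = j then 1 else 0)"
    and expansion: "x = (\<Sum>i\<le>d. scale (f i x) (v i))"
    and eigenvector: "i \<le> d \<Longrightarrow> A (v i) = scale (\<theta> i) (v i)"
    and eigenvalues_inj: "inj_on \<theta> {..d}"
    and linear_A: "Vector_Spaces.linear scale scale A"
begin

lemma coord_zero: "i \<le> d \<Longrightarrow> f i 0 = 0"
  using coord_scale[of i 0 0] by simp

lemma coord_sum:
  assumes "i \<le> d" "finite S"
  shows "f i (\<Sum>s\<in>S. h s) = (\<Sum>s\<in>S. f i (h s))"
  using assms(2) by induction (simp_all add: assms(1) coord_zero coord_add)

lemma linear_expansion:
  assumes "Vector_Spaces.linear scale scale T"
  shows "T x = (\<Sum>j\<le>d. scale (f j x) (T (v j)))"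
proof -
  interpret T: Vector_Spaces.linear scale scale T by fact
  show ?thesis
    by (subst expansion[of x]) (simp add: T.sum T.scale)
qed

lemma coord_linear:
  assumes "Vector_Spaces.linear scale scale T" "i \<le> d"
  shows "f i (T x) = (\<Sum>j\<le>d. f j x * f i (T (v j)))"
  by (subst linear_expansion[OF assms(1)]) (simp add: coord_sum coord_scale assms(2))

lemma coord_eigen:
  assumes "i \<le> d"
  shows "f i (A x) = \<theta> i * f i x"
proof -
  have "f i (A x) = (\<Sum>j\<le>d. f j x * f i (A (v j)))"
    by (rule coord_linear[OF linear_A assms])
  also have "\<dots> = (\<Sum>j\<le>d. if j = i then \<theta> i * f i x else 0)"
    by (rule sum.cong) (auto simp: eigenvector coord_scale coord_basis assms)
  finally show ?thesis using assms by simp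
qed

end

section \<open>The diagonal symmetric form and its radical\<close>

text \<open>The roles are asymmetric: \<open>A'\<close> is tridiagonal in the basis
  \<open>v\<close>, while \<open>A\<close> is only Hessenberg in the basis \<open>w\<close>. Since
  \<open>A (w 0)\<close> has no component along \<open>w m\<close> once \<open>m \<ge> 2\<close>,
  the argument reaches every such \<open>m\<close>; the corner is \<open>m = d\<close>.\<close>

lemma tridiagonal_imp_row_zero:
  assumes V: "eigen_coordinates scale d A v f \<theta>"
    and W: "eigen_coordinates scale d A' w g \<tau>"
    and tri: "\<And>i j. i \<le> d \<Longrightarrow> j \<le> d \<Longrightarrow> i > j + 1 \<or> j > i + 1 \<Longrightarrow> f i (A' (v j)) = 0"
    and sub: "\<And>j. j < d \<Longrightarrow> f (Suc j) (A' (v j)) \<noteq> 0"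
    and hess: "\<And>i j. i \<le> d \<Longrightarrow> j \<le> d \<Longrightarrow> i > j + 1 \<Longrightarrow> g i (A (w j)) = 0"
    and hess_sub: "\<And>j. j < d \<Longrightarrow> g (Suc j) (A (w j)) \<noteq> 0"
    and m: "2 \<le> m" "m \<le> d"
  shows "g 0 (A (w m)) = 0"
proof (rule ccontr)
  assume corner: "g 0 (A (w m)) \<noteq> 0"
  interpret V: eigen_coordinates scale d A v f \<theta> by fact
  interpret W: eigen_coordinates scale d A' w g \<tau> by fact
  define a where "a i j = f i (A' (v j))" for i j
  \<comment> \<open>These weights solve the recurrence that makes the matrix with entries
    \<open>k i * a i j\<close> symmetric. The denominators are nonzero by \<open>sub\<close>; a zero
    superdiagonal entry makes all later weights vanish. The empty product gives
    \<open>k 0 = 1\<close>, so \<open>B\<close> is not the zero form.\<close>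
  define k where "k i = (\<Prod>h<i. a h (Suc h) / a (Suc h) h)" for i
  define B where "B x y = (\<Sum>i\<le>d. k i * f i x * f i y)" for x y
  have k_step: "k (Suc i) * a (Suc i) i = k i * a i (Suc i)" if "i < d" for i
    using sub[OF that] by (simp add: k_def a_def)
  have k_sym: "k i * a i j = k j * a j i" if "i \<le> d" "j \<le> d" for i j
  proof -
    consider "i = j" | "i = Suc j" | "j = Suc i" | "i > j + 1 \<or> j > i + 1" by linarith
    then show ?thesis
    proof cases
      case 4
      then show ?thesis using tri[of i j] tri[of j i] that by (auto simp: a_def)
    qed (use k_step that in auto)
  qed
  have B_comm: "B x y = B y x" for x y
    by (simp add: B_def mult.assoc mult.commute mult.left_commute)
  have B_scale: "B (scale c x) y = c * B x y" for c x y
    by (simp add: B_def V.coord_scale sum_distrib_left mult_ac)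
  have B_sum: "B (\<Sum>s\<in>S. h s) y = (\<Sum>s\<in>S. B (h s) y)" if "finite S" for S :: "nat set" and h y
    unfolding B_def by (subst sum.swap)
      (simp add: V.coord_sum that sum_distrib_left sum_distrib_right)
  have B_expand: "B x y = (\<Sum>i\<le>d. g i x * B (w i) y)" for x y
    by (subst W.expansion[of x]) (simp add: B_sum B_scale)
  have A_adj: "B (A x) y = B x (A y)" for x y
    by (simp add: B_def V.coord_eigen mult_ac)
  have A'_adj: "B (A' x) y = B x (A' y)" for x y
  proof -
    have "B (A' x) y = (\<Sum>i\<le>d. \<Sum>j\<le>d. k i * a i j * f j x * f i y)"
      unfolding B_def a_def
      by (simp add: V.coord_linear[OF W.linear_A, of _ x] sum_distrib_left sum_distrib_right mult_ac)
    also have "\<dots> = (\<Sum>i\<le>d. \<Sum>j\<le>d. k j * a j i * f j x * f i y)"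
      by (intro sum.cong refl) (simp add: k_sym)
    also have "\<dots> = (\<Sum>j\<le>d. \<Sum>i\<le>d. k j * a j i * f j x * f i y)"
      by (rule sum.swap)
    also have "\<dots> = B x (A' y)"
      unfolding B_def a_def
      by (simp add: V.coord_linear[OF W.linear_A, of _ y] sum_distrib_left sum_distrib_right mult_ac)
    finally show ?thesis .
  qed
  have orth: "B (w i) (w j) = 0" if "i \<le> d" "j \<le> d" "i \<noteq> j" for i j
  proof -
    have "\<tau> i * B (w i) (w j) = B (A' (w i)) (w j)"
      by (simp add: W.eigenvector that B_scale)
    also have "\<dots> = B (A' (w j)) (w i)"
      by (metis A'_adj B_comm)
    also have "\<dots> = \<tau> j * B (w j) (w i)"
      by (simp add: W.eigenvector that B_scale)
    also have "\<dots> = \<tau> j * B (w i) (w j)"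
      by (simp only: B_comm[of "w j"])
    finally show ?thesis
      using W.eigenvalues_inj that by (auto dest: inj_onD)
  qed
  \<comment> \<open>The value \<open>B (A (w m)) (w 0)\<close> is computed twice. Expanding
    \<open>A (w m)\<close> leaves the term \<open>i = 0\<close> by orthogonality. Moving
    \<open>A\<close> onto \<open>w 0\<close> leaves at most the term \<open>i = m\<close>, whose
    coefficient vanishes because \<open>m > 0 + 1\<close>.\<close>
  have "g 0 (A (w m)) * B (w 0) (w 0) = (\<Sum>i\<le>d. if i = 0 then g 0 (A (w m)) * B (w 0) (w 0) else 0)"
    by simp
  also have "\<dots> = (\<Sum>i\<le>d. g i (A (w m)) * B (w i) (w 0))"
    by (rule sum.cong) (auto simp: orth)
  also have "\<dots> = B (A (w 0)) (w m)"
    by (metis B_expand A_adj B_comm)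
  also have "\<dots> = (\<Sum>i\<le>d. g i (A (w 0)) * B (w i) (w m))"
    by (rule B_expand)
  also have "\<dots> = 0"
  proof (rule sum.neutral, rule ballI)
    fix i assume "i \<in> {..d}"
    then show "g i (A (w 0)) * B (w i) (w m) = 0"
      using hess[of i 0] orth[of i m] m by (cases "i = m") auto
  qed
  finally have iso: "B (w 0) (w 0) = 0" using corner by simp
  \<comment> \<open>The vector \<open>w 0\<close> is isotropic and orthogonal to the other
    \<open>w i\<close>. Inductively, \<open>A (w i)\<close> is a combination of
    \<open>w 0, ..., w (Suc i)\<close> with nonzero last coefficient, so \<open>w (Suc i)\<close>
    follows its predecessors into the radical. The vector \<open>y\<close> stays arbitrary because
    the hypothesis is used at \<open>A y\<close>.\<close>
  have radical: "i \<le> d \<Longrightarrow> B (w i) y = 0" for i y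
  proof (induction i arbitrary: y rule: less_induct)
    case (less n)
    show ?case
    proof (cases n)
      case 0
      have "B y (w 0) = (\<Sum>i\<le>d. g i y * B (w i) (w 0))" by (rule B_expand)
      also have "\<dots> = 0"
        by (rule sum.neutral) (metis atMost_iff iso le0 mult_zero_right orth)
      finally show ?thesis using 0 B_comm by metis
    next
      case (Suc i)
      have "0 = B (w i) (A y)" using less.IH[of i "A y"] less.prems Suc by simp
      also have "\<dots> = (\<Sum>j\<le>d. g j (A (w i)) * B (w j) y)"
        by (metis A_adj B_expand)
      also have "\<dots> = (\<Sum>j\<le>d. if j = n then g n (A (w i)) * B (w n) y else 0)"
      proof (rule sum.cong[OF refl])
        fix j assume j: "j \<in> {..d}"
        consider "j < n" | "j = n" | "j > i + 1" using Suc by linarith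
        then show "g j (A (w i)) * B (w j) y = (if j = n then g n (A (w i)) * B (w n) y else 0)"
          using less.IH[of j y] hess[of j i] j less.prems Suc by cases auto
      qed
      also have "\<dots> = g n (A (w i)) * B (w n) y" using less.prems by simp
      finally show ?thesis using hess_sub[of i] less.prems Suc by simp
    qed
  qed
  \<comment> \<open>The radical is now everything, against
    \<open>B (v 0) (v 0) = k 0 = 1\<close>.\<close>
  have "B (v 0) (v 0) = 0"
    by (subst B_expand) (simp add: radical)
  moreover have "B (v 0) (v 0) = (\<Sum>i\<le>d. if i = 0 then 1 else 0)"
    unfolding B_def by (rule sum.cong) (auto simp: V.coord_basis k_def)
  ultimately show False by simp
qed

section \<open>Eigenbases from primitive idempotents\<close>

lemma (in vector_space) dim_1_multiple:
  assumes "dim S = 1" "x \<in> S" "x \<noteq> 0" "y \<in> S"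
  shows "\<exists>c. y = scale c x"
proof -
  obtain B where B: "B \<subseteq> S" "independent B" "S \<subseteq> span B" "card B = dim S"
    using basis_exists by blast
  then obtain b where "B = {b}" using assms(1) card_1_singletonE by metis
  then have "x \<in> range (\<lambda>c. scale c b)" "y \<in> range (\<lambda>c. scale c b)"
    using B(3) assms(2,4) by (auto simp: span_singleton)
  then obtain p q where p: "x = scale p b" and q: "y = scale q b" by blast
  with assms(3) have "p \<noteq> 0" by auto
  then have "y = scale (q / p) x" by (simp add: p q)
  then show ?thesis ..
qed

text \<open>Diagonalizability makes the \<open>E i\<close> sum to the identity, and one-dimensional
  eigenspaces make \<open>E i x\<close> a multiple of a chosen eigenvector \<open>v i\<close>; the
  factor is the coordinate \<open>f i x\<close>.\<close>

lemma eigen_coordinates_exist: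
  assumes "vector_space scale" and mf: "multiplicity_free scale A"
    and pid: "primitive_idempotents scale d A E"
  obtains v f \<theta> where "eigen_coordinates scale d A v f \<theta>"
    and "\<And>i x. i \<le> d \<Longrightarrow> E i x = scale (f i x) (v i)"
    and "\<And>i. i \<le> d \<Longrightarrow> v i \<noteq> 0"
proof -
  interpret vector_space scale by fact
  obtain W where bij: "bij_betw W {0..d} (eigenspaces scale A)"
    and E: "\<And>i. i \<le> d \<Longrightarrow> Vector_Spaces.linear scale scale (E i)"
    and E_id: "\<And>i x. i \<le> d \<Longrightarrow> x \<in> W i \<Longrightarrow> E i x = x"
    and E_0: "\<And>i j x. i \<le> d \<Longrightarrow> j \<le> d \<Longrightarrow> j \<noteq> i \<Longrightarrow> x \<in> W j \<Longrightarrow> E i x = 0"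
    using pid unfolding primitive_idempotents_def by blast
  have linA: "Vector_Spaces.linear scale scale A" and dim1: "\<And>S. S \<in> eigenspaces scale A \<Longrightarrow> dim S = 1"
    using mf by (auto simp: multiplicity_free_def)
  interpret A: Vector_Spaces.linear scale scale A by fact
  have W_in: "W i \<in> eigenspaces scale A" if "i \<le> d" for i
    using bij that by (auto simp: bij_betw_def)
  have "\<forall>i\<in>{..d}. \<exists>c x. W i = eigenspace scale A c \<and> x \<noteq> 0 \<and> A x = scale c x"
    using W_in by (fastforce simp: eigenspaces_def eigenvalue_def)
  then obtain \<theta> v where Wv: "\<And>i. i \<le> d \<Longrightarrow> W i = eigenspace scale A (\<theta> i)"
    and v_nz: "\<And>i. i \<le> d \<Longrightarrow> v i \<noteq> 0" and Av: "\<And>i. i \<le> d \<Longrightarrow> A (v i) = scale (\<theta> i) (v i)"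
    by (metis atMost_iff)
  have vW: "v i \<in> W i" if "i \<le> d" for i
    using that by (simp add: Wv Av eigenspace_def)
  have inj: "inj_on \<theta> {..d}"
    using bij Wv by (auto simp: bij_betw_def inj_on_def)
  obtain Bs where Bs: "span Bs = UNIV" "\<And>b. b \<in> Bs \<Longrightarrow> \<exists>c. A b = scale c b"
    using mf by (auto simp: multiplicity_free_def diagonalizable_def)
  have Bs_W: "\<exists>j\<le>d. b \<in> W j" if b: "b \<in> Bs" "b \<noteq> 0" for b
  proof -
    obtain c where c: "A b = scale c b" using Bs(2)[OF b(1)] by blast
    then have "eigenspace scale A c \<in> eigenspaces scale A"
      using b by (auto simp: eigenspaces_def eigenvalue_def)
    then have "eigenspace scale A c \<in> W ` {0..d}"
      using bij by (simp add: bij_betw_def)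
    then obtain j where "j \<le> d" "W j = eigenspace scale A c" by auto
    then show ?thesis using c by (auto simp: eigenspace_def)
  qed
  \<comment> \<open>Both claims are preserved under linear combinations, so they need checking only
    on the spanning eigenvectors, each of which is zero or lies in some \<open>W j\<close>.\<close>
  have E_sum: "x = (\<Sum>i\<le>d. E i x) \<and> (\<forall>i\<le>d. E i x \<in> W i)" for x
  proof -
    have "x \<in> span Bs" using Bs by simp
    then show ?thesis
    proof (induction rule: span_induct_alt)
      case base
      then show ?case
        by (simp add: module_hom.zero[OF E[unfolded linear_iff_module_hom]] Wv eigenspace_def A.zero)
    next
      case (step c b y)
      have lin: "E i (scale c b + y) = scale c (E i b) + E i y" if "i \<le> d" for i
        using E[OF that]
        by (simp add: module_hom.add module_hom.scale linear_iff_module_hom)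
      have "b = (\<Sum>i\<le>d. E i b) \<and> (\<forall>i\<le>d. E i b \<in> W i)"
      proof (cases "b = 0")
        case True
        then show ?thesis
          by (simp add: module_hom.zero[OF E[unfolded linear_iff_module_hom]] Wv eigenspace_def A.zero)
      next
        case False
        then obtain j where j: "j \<le> d" "b \<in> W j" using Bs_W step by blast
        have Eb: "E i b = (if i = j then b else 0)" if "i \<le> d" for i
          using that j E_id E_0 by auto
        then have "(\<Sum>i\<le>d. E i b) = (\<Sum>i\<le>d. if i = j then b else 0)"
          by (intro sum.cong) auto
        then show ?thesis using j Eb by (simp add: Wv eigenspace_def A.zero)
      qed
      then have b: "b = (\<Sum>i\<le>d. E i b)" "\<And>i. i \<le> d \<Longrightarrow> E i b \<in> W i" by auto
      have y: "y = (\<Sum>i\<le>d. E i y)" "\<And>i. i \<le> d \<Longrightarrow> E i y \<in> W i" using step by auto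
      have "(\<Sum>i\<le>d. E i (scale c b + y)) = scale c (\<Sum>i\<le>d. E i b) + (\<Sum>i\<le>d. E i y)"
        by (simp add: lin sum.distrib scale_sum_right)
      moreover have "E i (scale c b + y) \<in> W i" if "i \<le> d" for i
        using b(2)[OF that] y(2)[OF that] that
        by (simp add: lin Wv eigenspace_def A.add A.scale scale_right_distrib mult.commute)
      ultimately show ?case using b(1) y(1) by auto
    qed
  qed
  have "\<forall>i x. \<exists>c. i \<le> d \<longrightarrow> E i x = scale c (v i)"
    using dim_1_multiple[OF dim1[OF W_in]] vW v_nz E_sum by metis
  then obtain f where Ef: "\<And>i x. i \<le> d \<Longrightarrow> E i x = scale (f i x) (v i)"
    by metis
  have "eigen_coordinates scale d A v f \<theta>"
  proof unfold_locales
    fix i x y c assume i: "i \<le> d"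
    interpret Ei: Vector_Spaces.linear scale scale "E i" using E[OF i] .
    have "scale (f i (x + y)) (v i) = scale (f i x + f i y) (v i)"
      using Ei.add[of x y] by (simp add: Ef i scale_left_distrib)
    then show "f i (x + y) = f i x + f i y" using v_nz[OF i] by simp
    have "scale (f i (scale c x)) (v i) = scale (c * f i x) (v i)"
      using Ei.scale[of c x] by (simp add: Ef i)
    then show "f i (scale c x) = c * f i x" using v_nz[OF i] by simp
  next
    fix i j assume "i \<le> d" "j \<le> d"
    then have "scale (f i (v j)) (v i) = scale (if i = j then 1 else 0) (v i)"
      using Ef[of i "v j"] E_id[of i "v i"] E_0[of i j "v j"] vW by (cases "i = j") auto
    then show "f i (v j) = (if i = j then 1 else 0)"
      using v_nz[OF \<open>i \<le> d\<close>] scale_right_imp_eq by blast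
  next
    fix x
    have "(\<Sum>i\<le>d. E i x) = (\<Sum>i\<le>d. scale (f i x) (v i))"
      by (rule sum.cong) (auto simp: Ef)
    then show "x = (\<Sum>i\<le>d. scale (f i x) (v i))" using E_sum by metis
  qed (use Av inj in auto)
  then show thesis using that Ef v_nz by blast
qed

text \<open>The composite sends \<open>x\<close> to \<open>f j x * f i (T (v j))\<close> times
  \<open>v i\<close>, so it has rank at most one and is governed by a single matrix entry;
  evaluating at \<open>v j\<close> isolates that entry.\<close>

lemma sandwich_zero_iff:
  assumes V: "eigen_coordinates scale d A v f \<theta>"
    and Ef: "\<And>i x. i \<le> d \<Longrightarrow> E i x = scale (f i x) (v i)"
    and nz: "\<And>i. i \<le> d \<Longrightarrow> v i \<noteq> 0"
    and T: "Vector_Spaces.linear scale scale T"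
    and ij: "i \<le> d" "j \<le> d"
  shows "E i \<circ> T \<circ> E j = (\<lambda>_. 0) \<longleftrightarrow> f i (T (v j)) = 0"
proof -
  interpret V: eigen_coordinates scale d A v f \<theta> by fact
  interpret T: Vector_Spaces.linear scale scale T by fact
  have eq: "(E i \<circ> T \<circ> E j) x = scale (f j x * f i (T (v j))) (v i)" for x
    by (simp add: Ef ij T.scale V.coord_scale)
  show ?thesis
  proof
    assume "E i \<circ> T \<circ> E j = (\<lambda>_. 0)"
    then show "f i (T (v j)) = 0"
      using eq[of "v j"] nz[OF ij(1)] by (simp add: V.coord_basis ij)
  qed (use eq in auto)
qed

section \<open>Corner entries of Hessenberg systems\<close>

text \<open>Matrix form of the idempotent conditions, followed by
  \<open>tridiagonal_imp_row_zero\<close> at \<open>m = d\<close>. Tridiagonality is assumed on one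
  side only, so that the result also serves with the two sides exchanged.\<close>

lemma hessenberg_corner_zero:
  assumes vs: "vector_space scale" and d: "d \<ge> 2"
    and H: "hessenberg_system scale d (A, E, A', E')"
    and tri: "\<And>i j. i \<le> d \<Longrightarrow> j \<le> d \<Longrightarrow> i + 1 < j \<Longrightarrow> E i \<circ> A' \<circ> E j = (\<lambda>_. 0)"
  shows "E' 0 \<circ> A \<circ> E' d = (\<lambda>_. 0)"
proof -
  have mf: "multiplicity_free scale A" "multiplicity_free scale A'"
    and pid: "primitive_idempotents scale d A E" "primitive_idempotents scale d A' E'"
    using H by (auto simp: hessenberg_system_def)
  have hess: "\<And>i j. i \<le> d \<Longrightarrow> j \<le> d \<Longrightarrow> i > j + 1 \<Longrightarrow> E i \<circ> A' \<circ> E j = (\<lambda>_. 0)"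
    "\<And>j. j < d \<Longrightarrow> E (Suc j) \<circ> A' \<circ> E j \<noteq> (\<lambda>_. 0)"
    "\<And>i j. i \<le> d \<Longrightarrow> j \<le> d \<Longrightarrow> i > j + 1 \<Longrightarrow> E' i \<circ> A \<circ> E' j = (\<lambda>_. 0)"
    "\<And>j. j < d \<Longrightarrow> E' (Suc j) \<circ> A \<circ> E' j \<noteq> (\<lambda>_. 0)"
    using H unfolding hessenberg_system_def prod.case
    by (blast, metis Suc_eq_plus1 Suc_leI less_imp_le, blast, metis Suc_eq_plus1 Suc_leI less_imp_le)
  obtain v f \<theta> where V: "eigen_coordinates scale d A v f \<theta>"
    and vf: "\<And>i x. i \<le> d \<Longrightarrow> E i x = scale (f i x) (v i)" "\<And>i. i \<le> d \<Longrightarrow> v i \<noteq> 0"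
    using eigen_coordinates_exist[OF vs mf(1) pid(1)] by metis
  obtain w g \<tau> where W: "eigen_coordinates scale d A' w g \<tau>"
    and wg: "\<And>i x. i \<le> d \<Longrightarrow> E' i x = scale (g i x) (w i)" "\<And>i. i \<le> d \<Longrightarrow> w i \<noteq> 0"
    using eigen_coordinates_exist[OF vs mf(2) pid(2)] by metis
  note lin = eigen_coordinates.linear_A[OF V] eigen_coordinates.linear_A[OF W]
  note iffs = sandwich_zero_iff[where E=E, OF V vf lin(2), symmetric]
    sandwich_zero_iff[where E=E', OF W wg lin(1), symmetric]
  have "g 0 (A (w d)) = 0"
  proof (rule tridiagonal_imp_row_zero[OF V W])
    show "f i (A' (v j)) = 0" if "i \<le> d" "j \<le> d" "i > j + 1 \<or> j > i + 1" for i j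
      using that hess(1)[of i j] tri[of i j] by (auto simp: iffs)
    show "f (Suc j) (A' (v j)) \<noteq> 0" if "j < d" for j
      using that hess(2)[of j] by (simp add: iffs)
    show "g i (A (w j)) = 0" if "i \<le> d" "j \<le> d" "i > j + 1" for i j
      using that hess(3)[of i j] by (simp add: iffs)
    show "g (Suc j) (A (w j)) \<noteq> 0" if "j < d" for j
      using that hess(4)[of j] by (simp add: iffs)
  qed (use d in auto)
  then show ?thesis by (simp add: iffs)
qed

text \<open>Exchanging \<open>(A, E)\<close> with \<open>(A', E')\<close> again gives a Hessenberg
  system, so both directions are instances of \<open>hessenberg_corner_zero\<close>.\<close>

lemma QCHS_corner_iff:
  assumes vs: "vector_space scale" and d: "d \<ge> 2"
    and Q: "(A, E, A', E') \<in> QCHS scale d"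
  shows "E 0 \<circ> A' \<circ> E d = (\<lambda>_. 0) \<longleftrightarrow> E' 0 \<circ> A \<circ> E' d = (\<lambda>_. 0)"
proof -
  have H: "hessenberg_system scale d (A, E, A', E')" "hessenberg_system scale d (A', E', A, E)"
    using Q by (auto simp: QCHS_def hessenberg_system_def)
  \<comment> \<open>The corner is the only entry above the superdiagonal that the quasi-circular
    condition leaves free.\<close>
  have far: "i = 0 \<and> j = d \<or> j < i + d" if "i \<le> d" "j \<le> d" for i j :: nat
    using that by linarith
  have q: "E i \<circ> A' \<circ> E j = (\<lambda>_. 0) \<and> E' i \<circ> A \<circ> E' j = (\<lambda>_. 0)"
    if "i \<le> d" "j \<le> d" "i + 1 < j" "j < i + d" for i j
    using Q that by (simp add: QCHS_def)
  show ?thesis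
  proof
    assume "E 0 \<circ> A' \<circ> E d = (\<lambda>_. 0)"
    then show "E' 0 \<circ> A \<circ> E' d = (\<lambda>_. 0)"
      using hessenberg_corner_zero[OF vs d H(1)] far q by metis
  next
    assume "E' 0 \<circ> A \<circ> E' d = (\<lambda>_. 0)"
    then show "E 0 \<circ> A' \<circ> E d = (\<lambda>_. 0)"
      using hessenberg_corner_zero[OF vs d H(2)] far q by metis
  qed
qed

theorem mainTheorem2:
  fixes scale :: "'f::field \<Rightarrow> 'v::ab_group_add \<Rightarrow> 'v"
    and d :: nat
  assumes "vector_space scale"
    and "d \<ge> 2"
    and "vector_space.dim scale (UNIV :: 'v set) = d + 1"
  shows "QCHS scale d = CHS scale d \<union> THS scale d \<and> CHS scale d \<inter> THS scale d = {}"
proof -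
  \<comment> \<open>A system with exactly one zero corner would lie in neither family;
    \<open>QCHS_corner_iff\<close> excludes it.\<close>
  have split: "(A, E, A', E') \<in> CHS scale d \<or> (A, E, A', E') \<in> THS scale d"
    if Q: "(A, E, A', E') \<in> QCHS scale d" for A A' :: "'v \<Rightarrow> 'v" and E E'
  proof (cases "E 0 \<circ> A' \<circ> E d = (\<lambda>_. 0)")
    case True
    have far: "i = 0 \<and> j = d \<or> j < i + d" if "i \<le> d" "j \<le> d" for i j :: nat
      using that by linarith
    have "E i \<circ> A' \<circ> E j = (\<lambda>_. 0) \<and> E' i \<circ> A \<circ> E' j = (\<lambda>_. 0)"
      if "i \<le> d" "j \<le> d" "i + 1 < j" for i j
      using far[OF that(1,2)] True QCHS_corner_iff[OF assms(1,2) Q] Q that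
      by (auto simp: QCHS_def)
    then show ?thesis using Q by (simp add: QCHS_def THS_def)
  next
    case False
    then show ?thesis
      using QCHS_corner_iff[OF assms(1,2) Q] Q by (simp add: QCHS_def CHS_def)
  qed
  have "CHS scale d \<subseteq> QCHS scale d" "THS scale d \<subseteq> QCHS scale d"
    by (auto simp: CHS_def THS_def QCHS_def)
  moreover have "QCHS scale d \<subseteq> CHS scale d \<union> THS scale d"
    using split by auto
  \<comment> \<open>As \<open>d \<ge> 2\<close>, the pair \<open>(0, d)\<close> satisfies
    \<open>0 + 1 < d\<close>, so the tridiagonal condition kills the corner.\<close>
  moreover have "CHS scale d \<inter> THS scale d = {}"
    using assms(2) by (auto simp: CHS_def THS_def)
  ultimately show ?thesis by blast
qed

end
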